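(* Let $P$ be a normal fuzzy logic program over a complete lattice $(V,\leqslant)$ and a set of atoms $\Pi$. For any AFT stable model $(I,I)$ of $P$ (i.e. any interpretation $I$ with $\mathcal{T}_P^{\mathit{st}}(I,I)=(I,I)$), we have $\mathit{lfp}(\mathcal{T}_P^{\mathit{st}})\leq_p(I,I)$. Equivalently (for $P$ having exactly one rule $p\leftarrow\mathcal{B}_p$, of weight $1$, for each atom $p$, so that the approximate well-founded model $X_{\mathsf{SWF}}$ is defined), for any stable model $I$ of $P$ in the reduct sense (i.e. $I$ is the least model of the reduct $P_I$), we have $\zeta(X_{\mathsf{SWF}})\leq_p(I,I)$.
   Context: Setting. $(V,\leqslant)$ is a complete lattice of truth values with least element $0$, greatest element $1$, join $\vee$ and meet $\wedge$; $V'\subseteq V$ is a designated subset of truth values allowed as constants and weights; $\Pi$ is a set of atoms. Each $n$-ary connective $f$ has a truth function $f^{\cdot}\colon V^n\to V$. Truth functions of conjunctors, disjunctors and aggregators are monotone in each argument; a conjunctor $\&$ satisfies $x\mathbin{\&^{\cdot}}y\leqslant x$, $x\mathbin{\&^{\cdot}}y\leqslant y$, $x\mathbin{\&^{\cdot}}1=x=1\mathbin{\&^{\cdot}}x$; a disjunctor $|$ satisfies $x\leqslant x\mathbin{|^{\cdot}}y$, $y\leqslant x\mathbin{|^{\cdot}}y$, $x\mathbin{|^{\cdot}}0=x=0\mathbin{|^{\cdot}}x$. The truth function of an implicator is monotone in its first and antimonotone in its second argument. Each implicator $\leftarrow_i$ is paired with a conjunctor $\wedge_i$ forming an adjoint pair: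 for all $x,y,z\in V$, $y\wedge_i^{\cdot}x\leqslant z$ iff $y\leqslant z\leftarrow_i^{\cdot}x$. Default negation $\sim$ has a truth function $\sim^{\cdot}\colon V\to V$ that is an antimonotone involution. Normal fuzzy formulas are built from constants $c\in V'$, atoms $p$ and negated atoms $\sim p$ ($p\in\Pi$) using conjunctors, disjunctors and aggregators. A normal fuzzy logic program $P$ is a finite set of rules $p\leftarrow_i^{\vartheta}\mathcal{B}$ with head $p\in\Pi$, weight $\vartheta\in V'$ and body $\mathcal{B}$ a normal fuzzy formula. Interpretations are functions $I\colon\Pi\to V$, ordered pointwise ($\leq$); $\mathcal{I}$ is the complete lattice of all of them, with least element $\mathbf{0}$. $\hat I(\varphi)$ is the truth-functional evaluation. $I$ satisfies $p\leftarrow_i^{\vartheta}\mathcal{B}$ iff $\vartheta\leqslant I(p)\leftarrow_i^{\cdot}\hat I(\mathcal{B})$; $I$ is a model of a program iff it satisfies all its rules. On $\mathcal{I}^2$: $(L_1,U_1)\leq_p(L_2,U_2)$ iff $L_1\leq L_2$ and $U_2\leq U_1$; $(L_1,U_1)\leq_t(L_2,U_2)$ iff $L_1\leq L_2$ and $U_1\leq U_2$. Reduct: for an interpretation $I$ and a rule $p\leftarrow_i^{\vartheta}\mathcal{B}$, $\mathcal{B}_I$ is the positive formula obtained from $\mathcal{B}$ by evaluating every negated atom $\sim q$ to the fixed truth value $\sim^{\cdot}I(q)$ and keeping all positive atoms; $P_I=\{p\leftarrow_i^{\vartheta}\mathcal{B}_I : p\leftarrow_i^{\vartheta}\mathcal{B}\in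 P\}$. Evaluation under a pair $(L,U)\in\mathcal{I}^2$: $\widehat{(L,U)}(c)=c$, $\widehat{(L,U)}(p)=L(p)$, $\widehat{(L,U)}(\sim p)=\sim^{\cdot}U(p)$, and $\widehat{(L,U)}(f(\varphi_1,\dots,\varphi_n))=f^{\cdot}(\widehat{(L,U)}(\varphi_1),\dots,\widehat{(L,U)}(\varphi_n))$. The operator $\mathcal{T}_P\colon\mathcal{I}^2\to\mathcal{I}^2$ is $\mathcal{T}_P(L,U)_1(p)=\bigvee\{\vartheta\wedge_i^{\cdot}\widehat{(L,U)}(\mathcal{B}) : p\leftarrow_i^{\vartheta}\mathcal{B}\in P\}$, $\mathcal{T}_P(L,U)_2=\mathcal{T}_P(U,L)_1$ (subscripts denote components). Its stable operator is $\mathcal{T}_P^{\mathit{st}}(L,U)=(\mathit{lfp}(\mathcal{T}_P(\cdot,U)_1),\mathit{lfp}(\mathcal{T}_P(L,\cdot)_2))$; it is $\leq_p$-monotone and $\mathit{lfp}(\mathcal{T}_P^{\mathit{st}})$ is its $\leq_p$-least fixpoint. Approximate interpretations are functions $X\colon\Pi\to V\times V$; $\zeta(X)=(L,U)$ is the pair of interpretations with $X(p)=(L(p),U(p))$ for all $p$; orders are transported along the bijection $\zeta$. Pointwise, $(x_1,y_1)\otimes(x_2,y_2)=(x_1\wedge x_2,y_1\vee y_2)$ and $(x_1,y_1)\oplus(x_2,y_2)=(x_1\vee x_2,y_1\wedge y_2)$. Evaluation: $\hat X(c)=(c,c)$, $\hat X(p)=X(p)$, $\hat X(\sim p)=(\sim^{\cdot}u,\sim^{\cdot}\ell)$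 if $X(p)=(\ell,u)$, and other connectives are applied componentwise. For $P$ with exactly one rule $p\leftarrow\mathcal{B}_p$ (weight $1$) per atom: $\mathcal{S}_P(X)(p)=\hat X(\mathcal{B}_p)$; with $\zeta(X_{\mathtt f})=(\mathbf{0},\mathbf{0})$, $F_{P,X}(Y)=X_{\mathtt f}\otimes\mathcal{S}_P(X\oplus Y)$; $s_P(X)=\mathit{lfp}_{\leq_t}(F_{P,X})$; $\mathcal{AW}_P(X)=\mathcal{S}_P(X)\oplus s_P(X)$ (which is $\leq_p$-monotone); the approximate well-founded model is $X_{\mathsf{SWF}}=\mathit{lfp}_{\leq_p}(\mathcal{AW}_P)$. *)

theory Defs
  imports Main
begin

section \<open>Syntax and truth functions\<close>

text \<open>
  The complete lattice of truth values is a type \<open>'v\<close> of class \<open>complete_lattice\<close> (so 0 is \<open>bot\<close> and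
  1 is \<open>top\<close>), the set of atoms is a type \<open>'p\<close>; \<open>'f\<close> and \<open>'i\<close> contain the symbols for the
  connectives occurring in formulas and for the implicators. Connectives act on argument lists,
  and nothing is required of a truth function on lists whose length is not the arity.
  \<open>impl_tf S i z x\<close> is the value of \<open>z \<leftarrow>\<^sub>i x\<close> (consequent first), and
  \<open>impl_conj S i\<close> is the conjunctor paired with \<open>\<leftarrow>\<^sub>i\<close>.
\<close>

record ('f, 'i, 'v) fuzzy_lang =
  conjunctors :: "'f set"
  disjunctors :: "'f set"
  aggregators :: "'f set"
  implicators :: "'i set"
  arity :: "'f \<Rightarrow> nat"
  tf :: "'f \<Rightarrow> 'v list \<Rightarrow> 'v"
  impl_tf :: "'i \<Rightarrow> 'v \<Rightarrow> 'v \<Rightarrow> 'v"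
  impl_conj :: "'i \<Rightarrow> 'f"
  neg_tf :: "'v \<Rightarrow> 'v"
  truth_consts :: "'v set"

definition mono_each_arg :: "nat \<Rightarrow> ('v::order list \<Rightarrow> 'v) \<Rightarrow> bool" where
  "mono_each_arg n g \<longleftrightarrow>
     (\<forall>xs k y. length xs = n \<longrightarrow> k < n \<longrightarrow> xs ! k \<le> y \<longrightarrow> g xs \<le> g (xs[k := y]))"

locale fuzzy_language =
  fixes S :: "('f, 'i, 'v::complete_lattice) fuzzy_lang"
  assumes connective_mono:
      "f \<in> conjunctors S \<union> disjunctors S \<union> aggregators S \<Longrightarrow> mono_each_arg (arity S f) (tf S f)"
    and conj_arity: "f \<in> conjunctors S \<Longrightarrow> arity S f = 2"
    and conj_le1: "f \<in> conjunctors S \<Longrightarrow> tf S f [x, y] \<le> x"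
    and conj_le2: "f \<in> conjunctors S \<Longrightarrow> tf S f [x, y] \<le> y"
    and conj_top1: "f \<in> conjunctors S \<Longrightarrow> tf S f [x, top] = x"
    and conj_top2: "f \<in> conjunctors S \<Longrightarrow> tf S f [top, x] = x"
    and disj_arity: "f \<in> disjunctors S \<Longrightarrow> arity S f = 2"
    and disj_ge1: "f \<in> disjunctors S \<Longrightarrow> x \<le> tf S f [x, y]"
    and disj_ge2: "f \<in> disjunctors S \<Longrightarrow> y \<le> tf S f [x, y]"
    and disj_bot1: "f \<in> disjunctors S \<Longrightarrow> tf S f [x, bot] = x"
    and disj_bot2: "f \<in> disjunctors S \<Longrightarrow> tf S f [bot, x] = x"
    and impl_mono: "i \<in> implicators S \<Longrightarrow> z \<le> z' \<Longrightarrow> impl_tf S i z x \<le> impl_tf S i z' x"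
    and impl_antimono: "i \<in> implicators S \<Longrightarrow> x \<le> x' \<Longrightarrow> impl_tf S i z x' \<le> impl_tf S i z x"
    and impl_conj: "i \<in> implicators S \<Longrightarrow> impl_conj S i \<in> conjunctors S"
    and adjoint: "i \<in> implicators S \<Longrightarrow>
      tf S (impl_conj S i) [y, x] \<le> z \<longleftrightarrow> y \<le> impl_tf S i z x"
    and neg_antimono: "x \<le> y \<Longrightarrow> neg_tf S y \<le> neg_tf S x"
    and neg_involution: "neg_tf S (neg_tf S x) = x"

datatype ('f, 'v, 'p) nformula =
  Const 'v
| Atom 'p
| NegAtom 'p
| Conn 'f "('f, 'v, 'p) nformula list"

fun normal_formula :: "('f, 'i, 'v) fuzzy_lang \<Rightarrow> ('f, 'v, 'p) nformula \<Rightarrow> bool" where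
  "normal_formula S (Const c) \<longleftrightarrow> c \<in> truth_consts S"
| "normal_formula S (Atom p) \<longleftrightarrow> True"
| "normal_formula S (NegAtom p) \<longleftrightarrow> True"
| "normal_formula S (Conn f \<phi>s) \<longleftrightarrow>
     f \<in> conjunctors S \<union> disjunctors S \<union> aggregators S \<and> length \<phi>s = arity S f \<and>
     (\<forall>\<phi> \<in> set \<phi>s. normal_formula S \<phi>)"

datatype ('f, 'i, 'v, 'p) nrule =
  Rule (head: 'p) (implicator: 'i) (weight: 'v) (body: "('f, 'v, 'p) nformula")

type_synonym ('f, 'i, 'v, 'p) program = "('f, 'i, 'v, 'p) nrule set"

definition normal_rule :: "('f, 'i, 'v) fuzzy_lang \<Rightarrow> ('f, 'i, 'v, 'p) nrule \<Rightarrow> bool" where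
  "normal_rule S r \<longleftrightarrow>
     implicator r \<in> implicators S \<and> weight r \<in> truth_consts S \<and> normal_formula S (body r)"

definition normal_program :: "('f, 'i, 'v) fuzzy_lang \<Rightarrow> ('f, 'i, 'v, 'p) program \<Rightarrow> bool" where
  "normal_program S P \<longleftrightarrow> finite P \<and> (\<forall>r \<in> P. normal_rule S r)"


section \<open>Interpretations, models, reduct\<close>

type_synonym ('p, 'v) interp = "'p \<Rightarrow> 'v"

primrec eval :: "('f, 'i, 'v) fuzzy_lang \<Rightarrow> ('p, 'v) interp \<Rightarrow> ('f, 'v, 'p) nformula \<Rightarrow> 'v" where
  "eval S I (Const c) = c"
| "eval S I (Atom p) = I p"
| "eval S I (NegAtom p) = neg_tf S (I p)"
| "eval S I (Conn f \<phi>s) = tf S f (map (eval S I) \<phi>s)"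

definition satisfies_rule ::
    "('f, 'i, 'v::order) fuzzy_lang \<Rightarrow> ('p, 'v) interp \<Rightarrow> ('f, 'i, 'v, 'p) nrule \<Rightarrow> bool" where
  "satisfies_rule S I r \<longleftrightarrow>
     weight r \<le> impl_tf S (implicator r) (I (head r)) (eval S I (body r))"

definition model ::
    "('f, 'i, 'v::order) fuzzy_lang \<Rightarrow> ('f, 'i, 'v, 'p) program \<Rightarrow> ('p, 'v) interp \<Rightarrow> bool" where
  "model S P I \<longleftrightarrow> (\<forall>r \<in> P. satisfies_rule S I r)"

text \<open>
  The constants introduced by the reduct are arbitrary truth values, not necessarily members
  of \<open>truth_consts\<close>.
\<close>

primrec reduct_formula ::
    "('f, 'i, 'v) fuzzy_lang \<Rightarrow> ('p, 'v) interp \<Rightarrow> ('f, 'v, 'p) nformula \<Rightarrow> ('f, 'v, 'p) nformula" where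
  "reduct_formula S I (Const c) = Const c"
| "reduct_formula S I (Atom p) = Atom p"
| "reduct_formula S I (NegAtom p) = Const (neg_tf S (I p))"
| "reduct_formula S I (Conn f \<phi>s) = Conn f (map (reduct_formula S I) \<phi>s)"

definition reduct ::
    "('f, 'i, 'v) fuzzy_lang \<Rightarrow> ('f, 'i, 'v, 'p) program \<Rightarrow> ('p, 'v) interp \<Rightarrow> ('f, 'i, 'v, 'p) program" where
  "reduct S P I =
     (\<lambda>r. Rule (head r) (implicator r) (weight r) (reduct_formula S I (body r))) ` P"

definition stable_model ::
    "('f, 'i, 'v::order) fuzzy_lang \<Rightarrow> ('f, 'i, 'v, 'p) program \<Rightarrow> ('p, 'v) interp \<Rightarrow> bool" where
  "stable_model S P I \<longleftrightarrow>
     model S (reduct S P I) I \<and> (\<forall>J. model S (reduct S P I) J \<longrightarrow> I \<le> J)"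


section \<open>Pairs of interpretations and the stable operator\<close>

definition le_p :: "'b::ord \<times> 'b \<Rightarrow> 'b \<times> 'b \<Rightarrow> bool" (infix "\<le>\<^sub>p" 50) where
  "A \<le>\<^sub>p B \<longleftrightarrow> fst A \<le> fst B \<and> snd B \<le> snd A"

definition le_t :: "'b::ord \<times> 'b \<Rightarrow> 'b \<times> 'b \<Rightarrow> bool" (infix "\<le>\<^sub>t" 50) where
  "A \<le>\<^sub>t B \<longleftrightarrow> fst A \<le> fst B \<and> snd A \<le> snd B"

text \<open>
  The least fixpoint with respect to an explicitly given order. It is not the meet of all
  prefixpoints, as \<^const>\<open>lfp\<close> is: the operator \<open>F_op\<close> below need not be monotone with respect
  to \<open>\<le>\<^sub>t\<close>, and for it the two can differ although the least fixpoint exists.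
\<close>

definition least_fixpoint :: "('b \<Rightarrow> 'b \<Rightarrow> bool) \<Rightarrow> ('b \<Rightarrow> 'b) \<Rightarrow> 'b" where
  "least_fixpoint le f = (THE x. f x = x \<and> (\<forall>y. f y = y \<longrightarrow> le x y))"

primrec eval_pair ::
    "('f, 'i, 'v) fuzzy_lang \<Rightarrow> ('p, 'v) interp \<times> ('p, 'v) interp \<Rightarrow> ('f, 'v, 'p) nformula \<Rightarrow> 'v" where
  "eval_pair S LU (Const c) = c"
| "eval_pair S LU (Atom p) = fst LU p"
| "eval_pair S LU (NegAtom p) = neg_tf S (snd LU p)"
| "eval_pair S LU (Conn f \<phi>s) = tf S f (map (eval_pair S LU) \<phi>s)"

definition T_lower ::
    "('f, 'i, 'v::complete_lattice) fuzzy_lang \<Rightarrow> ('f, 'i, 'v, 'p) program \<Rightarrow>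
     ('p, 'v) interp \<times> ('p, 'v) interp \<Rightarrow> ('p, 'v) interp" where
  "T_lower S P LU p =
     Sup {tf S (impl_conj S (implicator r)) [weight r, eval_pair S LU (body r)] | r. r \<in> P \<and> head r = p}"

definition T_op ::
    "('f, 'i, 'v::complete_lattice) fuzzy_lang \<Rightarrow> ('f, 'i, 'v, 'p) program \<Rightarrow>
     ('p, 'v) interp \<times> ('p, 'v) interp \<Rightarrow> ('p, 'v) interp \<times> ('p, 'v) interp" where
  "T_op S P = (\<lambda>(L, U). (T_lower S P (L, U), T_lower S P (U, L)))"

definition T_stable ::
    "('f, 'i, 'v::complete_lattice) fuzzy_lang \<Rightarrow> ('f, 'i, 'v, 'p) program \<Rightarrow>
     ('p, 'v) interp \<times> ('p, 'v) interp \<Rightarrow> ('p, 'v) interp \<times> ('p, 'v) interp" where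
  "T_stable S P =
     (\<lambda>(L, U). (lfp (\<lambda>L'. fst (T_op S P (L', U))), lfp (\<lambda>U'. snd (T_op S P (L, U')))))"


section \<open>Approximate interpretations and the approximate well-founded model\<close>

type_synonym ('p, 'v) approx = "'p \<Rightarrow> 'v \<times> 'v"

definition zeta :: "('p, 'v) approx \<Rightarrow> ('p, 'v) interp \<times> ('p, 'v) interp" where
  "zeta X = (\<lambda>p. fst (X p), \<lambda>p. snd (X p))"

definition approx_le_p :: "('p, 'v::order) approx \<Rightarrow> ('p, 'v) approx \<Rightarrow> bool" where
  "approx_le_p X Y \<longleftrightarrow> zeta X \<le>\<^sub>p zeta Y"

definition approx_le_t :: "('p, 'v::order) approx \<Rightarrow> ('p, 'v) approx \<Rightarrow> bool" where
  "approx_le_t X Y \<longleftrightarrow> zeta X \<le>\<^sub>t zeta Y"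

definition approx_meet ::
    "('p, 'v::lattice) approx \<Rightarrow> ('p, 'v) approx \<Rightarrow> ('p, 'v) approx" (infixl "\<otimes>" 70) where
  "X \<otimes> Y = (\<lambda>p. (inf (fst (X p)) (fst (Y p)), sup (snd (X p)) (snd (Y p))))"

definition approx_join ::
    "('p, 'v::lattice) approx \<Rightarrow> ('p, 'v) approx \<Rightarrow> ('p, 'v) approx" (infixl "\<oplus>" 65) where
  "X \<oplus> Y = (\<lambda>p. (sup (fst (X p)) (fst (Y p)), inf (snd (X p)) (snd (Y p))))"

primrec eval_approx ::
    "('f, 'i, 'v) fuzzy_lang \<Rightarrow> ('p, 'v) approx \<Rightarrow> ('f, 'v, 'p) nformula \<Rightarrow> 'v \<times> 'v" where
  "eval_approx S X (Const c) = (c, c)"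
| "eval_approx S X (Atom p) = X p"
| "eval_approx S X (NegAtom p) = (neg_tf S (snd (X p)), neg_tf S (fst (X p)))"
| "eval_approx S X (Conn f \<phi>s) =
     (tf S f (map fst (map (eval_approx S X) \<phi>s)), tf S f (map snd (map (eval_approx S X) \<phi>s)))"

definition one_rule_per_atom :: "('f, 'i, 'v::complete_lattice, 'p) program \<Rightarrow> bool" where
  "one_rule_per_atom P \<longleftrightarrow>
     (\<forall>p. \<exists>!r. r \<in> P \<and> head r = p) \<and> (\<forall>r \<in> P. weight r = top)"

definition body_of :: "('f, 'i, 'v, 'p) program \<Rightarrow> 'p \<Rightarrow> ('f, 'v, 'p) nformula" where
  "body_of P p = body (THE r. r \<in> P \<and> head r = p)"

definition S_op ::
    "('f, 'i, 'v) fuzzy_lang \<Rightarrow> ('f, 'i, 'v, 'p) program \<Rightarrow> ('p, 'v) approx \<Rightarrow> ('p, 'v) approx" where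
  "S_op S P X p = eval_approx S X (body_of P p)"

definition X_false :: "('p, 'v::complete_lattice) approx" where
  "X_false = (\<lambda>p. (bot, bot))"

definition F_op ::
    "('f, 'i, 'v::complete_lattice) fuzzy_lang \<Rightarrow> ('f, 'i, 'v, 'p) program \<Rightarrow>
     ('p, 'v) approx \<Rightarrow> ('p, 'v) approx \<Rightarrow> ('p, 'v) approx" where
  "F_op S P X Y = X_false \<otimes> S_op S P (X \<oplus> Y)"

definition s_op ::
    "('f, 'i, 'v::complete_lattice) fuzzy_lang \<Rightarrow> ('f, 'i, 'v, 'p) program \<Rightarrow>
     ('p, 'v) approx \<Rightarrow> ('p, 'v) approx" where
  "s_op S P X = least_fixpoint approx_le_t (F_op S P X)"

definition AW_op ::
    "('f, 'i, 'v::complete_lattice) fuzzy_lang \<Rightarrow> ('f, 'i, 'v, 'p) program \<Rightarrow>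
     ('p, 'v) approx \<Rightarrow> ('p, 'v) approx" where
  "AW_op S P X = S_op S P X \<oplus> s_op S P X"

definition X_SWF ::
    "('f, 'i, 'v::complete_lattice) fuzzy_lang \<Rightarrow> ('f, 'i, 'v, 'p) program \<Rightarrow> ('p, 'v) approx" where
  "X_SWF S P = least_fixpoint approx_le_p (AW_op S P)"

end

(*
  Both halves follow from the Knaster-Tarski theorem for the precision order: the least fixpoint
  of a monotone operator lies below every prefixpoint, so it suffices that (I, I) is a prefixpoint.
  For the stable operator this is the hypothesis. For the approximate well-founded operator, write
  T for the lower component of the operator T_P. With one rule per atom the operator maps (L, U) to
  the pair (T (L, U), inf (T (U, L)) J), where J is the least fixpoint of J' |-> T (inf U J', L).
  If I is stable, then I is the least prefixpoint of T (_, I); for L = U = I one gets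
  J = T (inf I J, I) <= T (I, I) = I, so J is itself a fixpoint of T (_, I), whence I <= J.
*)
theory Submission
  imports Defs
begin

section \<open>Least fixpoints with respect to an explicit order\<close>

lemma least_fixpoint_eqI:
  assumes antisym: "\<And>x y. le x y \<Longrightarrow> le y x \<Longrightarrow> x = y"
    and "f x = x" and "\<And>y. f y = y \<Longrightarrow> le x y"
  shows "least_fixpoint le f = x"
  unfolding least_fixpoint_def using assms by (intro the_equality) auto

text \<open>Knaster-Tarski: the meet \<open>g\<close> of all prefixpoints is itself a prefixpoint by
  monotonicity, and \<open>f g\<close> is then one too, which forces \<open>f g = g\<close>. The
  order is a parameter because neither precision order is the type class order on its
  carrier.\<close>

lemma least_fixpoint_lowerbound:
  assumes antisym: "\<And>x y. le x y \<Longrightarrow> le y x \<Longrightarrow> x = y"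
    and trans: "\<And>x y z. le x y \<Longrightarrow> le y z \<Longrightarrow> le x z"
    and refl: "\<And>x. le x x"
    and glb: "\<And>A. \<exists>g. (\<forall>a\<in>A. le g a) \<and> (\<forall>h. (\<forall>a\<in>A. le h a) \<longrightarrow> le h g)"
    and mono: "\<And>x y. le x y \<Longrightarrow> le (f x) (f y)"
    and pre: "le (f y) y"
  shows "le (least_fixpoint le f) y"
proof -
  obtain g where lower: "\<And>a. le (f a) a \<Longrightarrow> le g a"
    and greatest: "\<And>h. (\<And>a. le (f a) a \<Longrightarrow> le h a) \<Longrightarrow> le h g"
    using glb[of "{a. le (f a) a}"] by auto
  have fg: "le (f g) g"
    by (rule greatest) (blast intro: trans mono lower)
  moreover have "le g (f g)"
    by (rule lower) (rule mono[OF fg])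
  ultimately have "f g = g" by (rule antisym)
  then have "least_fixpoint le f = g"
    by (intro least_fixpoint_eqI antisym lower) (simp_all add: refl)
  with lower[OF pre] show ?thesis by simp
qed

lemma least_fixpoint_le_p_lowerbound:
  fixes f :: "'b::complete_lattice \<times> 'b \<Rightarrow> 'b \<times> 'b"
  assumes "\<And>x y. x \<le>\<^sub>p y \<Longrightarrow> f x \<le>\<^sub>p f y" and "f y \<le>\<^sub>p y"
  shows "least_fixpoint (\<le>\<^sub>p) f \<le>\<^sub>p y"
proof (rule least_fixpoint_lowerbound[where le = "(\<le>\<^sub>p)"])
  fix A :: "('b \<times> 'b) set"
  show "\<exists>g. (\<forall>a\<in>A. g \<le>\<^sub>p a) \<and> (\<forall>h. (\<forall>a\<in>A. h \<le>\<^sub>p a) \<longrightarrow> h \<le>\<^sub>p g)"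
    \<comment> \<open>Precision reverses the order of upper components, so the infimum of
      \<open>A\<close> takes joins there.\<close>
    by (rule exI[of _ "(INF a\<in>A. fst a, SUP a\<in>A. snd a)"])
      (auto simp: le_p_def intro: INF_lower SUP_upper INF_greatest SUP_least)
qed (use assms in \<open>auto simp: le_p_def prod_eq_iff\<close>)

lemma zeta_inject: "zeta X = zeta Y \<longleftrightarrow> X = Y"
  by (auto simp: zeta_def fun_eq_iff prod_eq_iff)

lemma zeta_surj: "\<exists>X. zeta X = LU"
  by (rule exI[of _ "\<lambda>p. (fst LU p, snd LU p)"]) (simp add: zeta_def)

lemma approx_le_p_antisym: "approx_le_p X Y \<Longrightarrow> approx_le_p Y X \<Longrightarrow> X = Y"
  unfolding approx_le_p_def le_p_def zeta_inject[symmetric] prod_eq_iff by (simp add: antisym)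

lemma approx_le_t_antisym: "approx_le_t X Y \<Longrightarrow> approx_le_t Y X \<Longrightarrow> X = Y"
  unfolding approx_le_t_def le_t_def zeta_inject[symmetric] prod_eq_iff by (simp add: antisym)

lemma least_fixpoint_approx_le_p_lowerbound:
  fixes f :: "('p, 'v::complete_lattice) approx \<Rightarrow> ('p, 'v) approx"
  assumes "\<And>X Y. approx_le_p X Y \<Longrightarrow> approx_le_p (f X) (f Y)" and "approx_le_p (f Y) Y"
  shows "approx_le_p (least_fixpoint approx_le_p f) Y"
proof (rule least_fixpoint_lowerbound[where le = approx_le_p])
  fix A :: "('p, 'v) approx set"
  obtain g where "zeta g = (INF X\<in>A. fst (zeta X), SUP X\<in>A. snd (zeta X))"
    using zeta_surj by blast
  then show "\<exists>g. (\<forall>a\<in>A. approx_le_p g a) \<and> (\<forall>h. (\<forall>a\<in>A. approx_le_p h a) \<longrightarrow> approx_le_p h g)"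
    by (intro exI[of _ g])
      (auto simp: approx_le_p_def le_p_def intro: INF_lower SUP_upper INF_greatest SUP_least)
qed (use assms approx_le_p_antisym in \<open>auto simp: approx_le_p_def le_p_def\<close>)


section \<open>Evaluation\<close>

text \<open>Monotonicity in single arguments yields joint monotonicity by replacing the entries of
  \<open>xs\<close> by those of \<open>ys\<close> one at a time, from the left.\<close>

lemma mono_each_argD:
  assumes "mono_each_arg n g" and "length xs = n" and "list_all2 (\<le>) xs ys"
  shows "g xs \<le> g ys"
proof -
  have len: "length ys = n" using assms by (auto dest: list_all2_lengthD)
  have "g xs \<le> g (take k ys @ drop k xs)" if "k \<le> n" for k
    using that
  proof (induction k)
    case (Suc k)
    let ?zs = "take k ys @ drop k xs"
    have "g ?zs \<le> g (?zs[k := ys ! k])"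
      using assms Suc.prems len unfolding mono_each_arg_def
      by (auto simp: nth_append list_all2_conv_all_nth)
    moreover have "?zs[k := ys ! k] = take (Suc k) ys @ drop (Suc k) xs"
      using assms(2) Suc.prems len
      by (simp add: list_update_append take_Suc_conv_app_nth Cons_nth_drop_Suc[symmetric])
    ultimately show ?case using Suc by (auto intro: order_trans)
  qed simp
  from this[of n] show ?thesis using assms(2) len by simp
qed

text \<open>The reduct freezes negated atoms at their value under \<open>I\<close>, which is what
  taking \<open>I\<close> as upper component does.\<close>

lemma eval_reduct_formula: "eval S J (reduct_formula S I \<phi>) = eval_pair S (J, I) \<phi>"
  by (induction \<phi>) (simp_all add: comp_def cong: map_cong)

lemma eval_approx_eq_eval_pair:
  "eval_approx S X \<phi> = (eval_pair S (zeta X) \<phi>, eval_pair S (snd (zeta X), fst (zeta X)) \<phi>)"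
  by (induction \<phi>) (simp_all add: comp_def zeta_def cong: map_cong)

lemma zeta_approx_join:
  "zeta (X \<oplus> Y) =
    (sup (fst (zeta X)) (fst (zeta Y)), inf (snd (zeta X)) (snd (zeta Y)))"
  by (simp add: zeta_def approx_join_def fun_eq_iff)

lemma zeta_X_false_meet:
  "zeta (X_false \<otimes> Y) = (bot, snd (zeta Y))"
  by (simp add: zeta_def approx_meet_def X_false_def fun_eq_iff)

context fuzzy_language
begin

text \<open>Negated atoms read the upper component, which shrinks as precision grows; antimonotone
  negation turns this into an increase.\<close>

lemma eval_pair_mono:
  assumes "normal_formula S \<phi>" and "LU \<le>\<^sub>p LU'"
  shows "eval_pair S LU \<phi> \<le> eval_pair S LU' \<phi>"
  using assms
proof (induction \<phi>)
  case (NegAtom p)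
  then show ?case by (auto simp: le_p_def le_fun_def intro: neg_antimono)
next
  case (Conn f \<phi>s)
  then have "mono_each_arg (arity S f) (tf S f)" and "length \<phi>s = arity S f"
    using connective_mono[of f] by auto
  moreover have "list_all2 (\<le>) (map (eval_pair S LU) \<phi>s) (map (eval_pair S LU') \<phi>s)"
    using Conn by (auto simp: list_all2_conv_all_nth)
  ultimately show ?case by (auto intro: mono_each_argD)
qed (auto simp: le_p_def le_fun_def)

lemma conj_mono:
  assumes "f \<in> conjunctors S" and "x \<le> x'" and "y \<le> y'"
  shows "tf S f [x, y] \<le> tf S f [x', y']"
  using connective_mono[of f] assms conj_arity[of f] by (intro mono_each_argD[of 2]) auto

end


section \<open>The stable operator\<close>

locale fuzzy_program = fuzzy_language S
  for S :: "('f, 'i, 'v::complete_lattice) fuzzy_lang" +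
  fixes P :: "('f, 'i, 'v, 'p) program"
  assumes normal: "normal_program S P"
begin

lemma rule_conj: "r \<in> P \<Longrightarrow> impl_conj S (implicator r) \<in> conjunctors S"
  and rule_body: "r \<in> P \<Longrightarrow> normal_formula S (body r)"
  using normal impl_conj by (auto simp: normal_program_def normal_rule_def)

lemma T_lower_mono:
  assumes "L \<le> L'" and "U' \<le> U"
  shows "T_lower S P (L, U) \<le> T_lower S P (L', U')"
proof (rule le_funI)
  fix p
  show "T_lower S P (L, U) p \<le> T_lower S P (L', U') p"
    unfolding T_lower_def
  proof (rule Sup_mono, clarify)
    fix r assume r: "r \<in> P" "p = head r"
    have "eval_pair S (L, U) (body r) \<le> eval_pair S (L', U') (body r)"
      using r assms by (intro eval_pair_mono rule_body) (auto simp: le_p_def)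
    then have "tf S (impl_conj S (implicator r)) [weight r, eval_pair S (L, U) (body r)]
        \<le> tf S (impl_conj S (implicator r)) [weight r, eval_pair S (L', U') (body r)]"
      using r by (intro conj_mono rule_conj) auto
    then show "\<exists>b\<in>{tf S (impl_conj S (implicator ra)) [weight ra, eval_pair S (L', U') (body ra)]
          |ra. ra \<in> P \<and> head ra = head r}.
        tf S (impl_conj S (implicator r)) [weight r, eval_pair S (L, U) (body r)] \<le> b"
      using r by blast
  qed
qed

lemma T_stable_mono:
  assumes "A \<le>\<^sub>p B"
  shows "T_stable S P A \<le>\<^sub>p T_stable S P B"
  using assms by (auto simp: T_stable_def T_op_def le_p_def split: prod.splits
      intro!: lfp_mono T_lower_mono)

text \<open>Adjointness turns satisfaction of each rule into an upper bound on one member of the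
  supremum in \<open>T_lower\<close>. Stable models are thus the least prefixpoints of
  \<open>T_lower S P (_, I)\<close>.\<close>

lemma model_reduct_iff: "model S (reduct S P I) J \<longleftrightarrow> T_lower S P (J, I) \<le> J"
proof -
  have "model S (reduct S P I) J \<longleftrightarrow>
      (\<forall>r\<in>P. tf S (impl_conj S (implicator r)) [weight r, eval_pair S (J, I) (body r)] \<le> J (head r))"
    using normal
    by (auto simp: model_def reduct_def satisfies_rule_def eval_reduct_formula adjoint
        normal_program_def normal_rule_def)
  also have "\<dots> \<longleftrightarrow> T_lower S P (J, I) \<le> J"
    by (auto simp: le_fun_def T_lower_def Sup_le_iff)
  finally show ?thesis .
qed

end


section \<open>The approximate well-founded model\<close>

locale one_rule_program = fuzzy_program +
  assumes one_rule: "one_rule_per_atom P"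
begin

text \<open>The supremum ranges over a singleton, and the weight \<open>top\<close> is neutral for
  the conjunctor.\<close>

lemma T_lower_eq: "T_lower S P LU p = eval_pair S LU (body_of P p)"
proof -
  obtain r where r: "r \<in> P" "head r = p" and unique: "\<And>q. q \<in> P \<Longrightarrow> head q = p \<Longrightarrow> q = r"
    using one_rule unfolding one_rule_per_atom_def by metis
  have the_rule: "(THE r. r \<in> P \<and> head r = p) = r"
    using r unique by blast
  have "{tf S (impl_conj S (implicator q)) [weight q, eval_pair S LU (body q)] |q. q \<in> P \<and> head q = p}
      = {tf S (impl_conj S (implicator r)) [weight r, eval_pair S LU (body r)]}"
    using r unique by blast
  moreover have "weight r = top"
    using one_rule r by (simp add: one_rule_per_atom_def)
  ultimately show ?thesis
    using r by (simp add: T_lower_def body_of_def the_rule conj_top2 rule_conj)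
qed

lemma zeta_S_op: "zeta (S_op S P X) = T_op S P (zeta X)"
  by (simp add: zeta_def[of "S_op S P X"] S_op_def eval_approx_eq_eval_pair T_lower_eq T_op_def
      fun_eq_iff split: prod.splits)

lemma zeta_F_op:
  "zeta (F_op S P X Y) =
    (bot, T_lower S P (inf (snd (zeta X)) (snd (zeta Y)), sup (fst (zeta X)) (fst (zeta Y))))"
  by (simp add: F_op_def zeta_X_false_meet zeta_S_op zeta_approx_join T_op_def)

text \<open>Every fixpoint of \<open>F_op S P X\<close> has lower component \<open>bot\<close>, so
  joining it to that of \<open>X\<close> changes nothing and negated atoms see a fixed
  interpretation. What remains is a monotone operator on upper components, so the least fixpoint
  exists although \<open>F_op\<close> need not be monotone for \<open>\<le>\<^sub>t\<close>.\<close>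

lemma zeta_s_op:
  "zeta (s_op S P X) = (bot, lfp (\<lambda>U. T_lower S P (inf (snd (zeta X)) U, fst (zeta X))))"
    (is "_ = (bot, lfp ?G)")
proof -
  have "mono ?G" by (intro monoI T_lower_mono) (auto intro: le_infI2)
  then have fp: "?G (lfp ?G) = lfp ?G" by (rule lfp_fixpoint)
  obtain Y where Y: "zeta Y = (bot, lfp ?G)" using zeta_surj by blast
  have "s_op S P X = Y"
    unfolding s_op_def
  proof (rule least_fixpoint_eqI)
    show "F_op S P X Y = Y"
      unfolding zeta_inject[symmetric] zeta_F_op Y using fp by simp
  next
    fix Z assume "F_op S P X Z = Z"
    then have Z: "zeta Z =
        (bot, T_lower S P (inf (snd (zeta X)) (snd (zeta Z)), sup (fst (zeta X)) (fst (zeta Z))))"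
      using zeta_F_op[of X Z] by simp
    then have "fst (zeta Z) = bot" by (rule ssubst) simp
    with Z have "?G (snd (zeta Z)) = snd (zeta Z)" by (simp add: prod_eq_iff)
    then have "lfp ?G \<le> snd (zeta Z)" by (intro lfp_lowerbound) simp
    then show "approx_le_t Y Z" by (simp add: approx_le_t_def le_t_def Y)
  qed (rule approx_le_t_antisym)
  with Y show ?thesis by simp
qed

lemma zeta_AW_op:
  assumes "zeta X = (L, U)"
  shows "zeta (AW_op S P X) =
    (T_lower S P (L, U), inf (T_lower S P (U, L)) (lfp (\<lambda>J. T_lower S P (inf U J, L))))"
  by (simp add: AW_op_def zeta_approx_join zeta_S_op zeta_s_op assms T_op_def)

text \<open>In the upper component, \<open>U\<close> occurs only positively and \<open>L\<close>
  only negatively, so shrinking \<open>U\<close> and enlarging \<open>L\<close> lowers the operator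
  under \<open>lfp\<close> pointwise.\<close>

lemma AW_op_mono:
  assumes "approx_le_p X Y"
  shows "approx_le_p (AW_op S P X) (AW_op S P Y)"
proof -
  obtain L U L' U' where X: "zeta X = (L, U)" and Y: "zeta Y = (L', U')" by fastforce
  with assms have "L \<le> L'" "U' \<le> U" by (auto simp: approx_le_p_def le_p_def)
  then show ?thesis
    unfolding approx_le_p_def le_p_def zeta_AW_op[OF X] zeta_AW_op[OF Y] fst_conv snd_conv
    by (intro conjI inf_mono lfp_mono T_lower_mono order_refl)
qed

lemma X_SWF_le_stable_model:
  assumes "stable_model S P I"
  shows "zeta (X_SWF S P) \<le>\<^sub>p (I, I)"
proof -
  have pre: "T_lower S P (I, I) \<le> I"
    and least: "\<And>J. T_lower S P (J, I) \<le> J \<Longrightarrow> I \<le> J"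
    using assms by (auto simp: stable_model_def model_reduct_iff)
  \<comment> \<open>By monotonicity \<open>T_lower S P (I, I)\<close> is again a prefixpoint, so
    leastness of \<open>I\<close> applies to it.\<close>
  have post: "I \<le> T_lower S P (I, I)"
    by (intro least T_lower_mono pre order_refl)
  define J where "J = lfp (\<lambda>J. T_lower S P (inf I J, I))"
  have "mono (\<lambda>J. T_lower S P (inf I J, I))"
    by (intro monoI T_lower_mono) (auto intro: le_infI2)
  then have J: "T_lower S P (inf I J, I) = J"
    unfolding J_def by (rule lfp_fixpoint)
  have "J \<le> T_lower S P (I, I)"
    by (subst J[symmetric]) (simp add: T_lower_mono)
  with pre have "inf I J = J" by (auto intro: inf_absorb2 order_trans)
  with J have "I \<le> J" by (intro least) simp
  obtain X where X: "zeta X = (I, I)" using zeta_surj by blast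
  \<comment> \<open>\<open>pre\<close> bounds the lower component; \<open>post\<close> and
    \<open>I \<le> J\<close> bound the two parts of the meet in the upper one.\<close>
  have "approx_le_p (AW_op S P X) X"
    unfolding approx_le_p_def zeta_AW_op[OF X] X le_p_def
    using pre post \<open>I \<le> J\<close> by (simp add: J_def)
  with AW_op_mono have "approx_le_p (X_SWF S P) X"
    unfolding X_SWF_def by (intro least_fixpoint_approx_le_p_lowerbound)
  then show ?thesis by (simp add: approx_le_p_def X)
qed

end

theorem theorem8:
  fixes S :: "('f, 'i, 'v::complete_lattice) fuzzy_lang"
    and P :: "('f, 'i, 'v, 'p) program"
  assumes "fuzzy_language S" and "normal_program S P"
  shows "(\<forall>I :: ('p, 'v) interp.
            T_stable S P (I, I) = (I, I) \<longrightarrow> least_fixpoint (\<le>\<^sub>p) (T_stable S P) \<le>\<^sub>p (I, I))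
       \<and> (one_rule_per_atom P \<longrightarrow>
            (\<forall>I :: ('p, 'v) interp. stable_model S P I \<longrightarrow> zeta (X_SWF S P) \<le>\<^sub>p (I, I)))"
proof -
  interpret fuzzy_program S P
    using assms by (simp add: fuzzy_program_def fuzzy_program_axioms_def)
  have "least_fixpoint (\<le>\<^sub>p) (T_stable S P) \<le>\<^sub>p (I, I)" if "T_stable S P (I, I) = (I, I)" for I
    using that by (intro least_fixpoint_le_p_lowerbound T_stable_mono) (auto simp: le_p_def)
  moreover have "zeta (X_SWF S P) \<le>\<^sub>p (I, I)" if "one_rule_per_atom P" and "stable_model S P I" for I
  proof -
    interpret one_rule_program S P
      by unfold_locales (rule that(1))
    show ?thesis using that(2) by (rule X_SWF_le_stable_model)
  qed
  ultimately show ?thesis by blast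
qed

end
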